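(* Let $n\geq 0$ and $k\geq 1$ be integers, let $\alpha_0,\dots,\alpha_{n-1}$ be real numbers, let $\ell_1,\dots,\ell_k$ be non-zero real numbers and let $z$ be a real number. Define $$C_{n,L}^{(k)}(z;\overline{\alpha})=\int_0^{\ell_1}\cdots\int_0^{\ell_k}\prod_{i=0}^{n-1}\left(x_1x_2\cdots x_k-\alpha_i-z\right)dx_1\cdots dx_k,$$ $$\hat{C}_{n,L}^{(k)}(z;\overline{\alpha})=\int_0^{\ell_1}\cdots\int_0^{\ell_k}\prod_{i=0}^{n-1}\left(-x_1x_2\cdots x_k-\alpha_i+z\right)dx_1\cdots dx_k.$$ Then (i) $$C_{n,L}^{(k)}(z;\overline{\alpha})=\sum_{i=0}^{n}\sum_{m=i}^{n}(-1)^i\binom{m}{i}\frac{s_{\overline{\alpha}}(n,m)\left(\ell_1\ell_2\cdots\ell_k\right)^{m-i+1}}{(m-i+1)^k}\,z^i,$$ (ii) $$\hat{C}_{n,L}^{(k)}(z;\overline{\alpha})=\sum_{i=0}^{n}\sum_{m=i}^{n}(-1)^{i+n}\binom{m}{i}\frac{|s_{\overline{\alpha}}(n,m)|\left(\ell_1\ell_2\cdots\ell_k\right)^{m-i+1}}{(m-i+1)^k}\,z^i.$$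
   Context: The generalized Stirling numbers of the first kind $s_{\overline{\alpha}}(n,m)$ are defined by $\prod_{i=0}^{n-1}(x-\alpha_i)=\sum_{m=0}^{n}s_{\overline{\alpha}}(n,m)x^m$, and the signless ones $|s_{\overline{\alpha}}(n,m)|$ by $\prod_{i=0}^{n-1}(x+\alpha_i)=\sum_{m=0}^{n}|s_{\overline{\alpha}}(n,m)|x^m$. *)

theory Defs
  imports "HOL-Analysis.Analysis" "HOL-Computational_Algebra.Polynomial"
begin

definition gen_stirling1 :: "(nat \<Rightarrow> real) \<Rightarrow> nat \<Rightarrow> nat \<Rightarrow> real" where
  "gen_stirling1 \<alpha> n m = coeff (\<Prod>i<n. [:- \<alpha> i, 1:]) m"

(* "Signless" is the traditional name: for real parameters of arbitrary sign this is
   the coefficient in the product of the x + \<alpha> i, in general not an absolute value. *)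
definition signless_gen_stirling1 :: "(nat \<Rightarrow> real) \<Rightarrow> nat \<Rightarrow> nat \<Rightarrow> real" where
  "signless_gen_stirling1 \<alpha> n m = coeff (\<Prod>i<n. [:\<alpha> i, 1:]) m"

lemma gen_stirling1_expansion:
  "(\<Prod>i<n. x - \<alpha> i) = (\<Sum>m=0..n. gen_stirling1 \<alpha> n m * x ^ m)"
proof -
  let ?p = "\<Prod>i<n. [:- \<alpha> i, 1:]"
  have "degree ?p \<le> n"
    using degree_prod_sum_le[of "{..<n}" "\<lambda>i. [:- \<alpha> i, 1:]"] by simp
  then have "poly ?p x = (\<Sum>m\<le>n. coeff ?p m * x ^ m)"
    unfolding poly_altdef by (intro sum.mono_neutral_left) (auto simp: coeff_eq_0)
  then show ?thesis
    by (simp add: gen_stirling1_def poly_prod atLeast0AtMost)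
qed

lemma signless_gen_stirling1_expansion:
  "(\<Prod>i<n. x + \<alpha> i) = (\<Sum>m=0..n. signless_gen_stirling1 \<alpha> n m * x ^ m)"
proof -
  let ?p = "\<Prod>i<n. [:\<alpha> i, 1:]"
  have "degree ?p \<le> n"
    using degree_prod_sum_le[of "{..<n}" "\<lambda>i. [:\<alpha> i, 1:]"] by simp
  then have "poly ?p x = (\<Sum>m\<le>n. coeff ?p m * x ^ m)"
    unfolding poly_altdef by (intro sum.mono_neutral_left) (auto simp: coeff_eq_0)
  then show ?thesis
    by (simp add: signless_gen_stirling1_def poly_prod atLeast0AtMost add.commute)
qed

(* The k-fold iterated integral of F over the variables x 1, ..., x k, where x j runs
   from 0 to l j; x 1 is innermost.  The integrals are oriented, so a negative
   l j contributes the integral over the interval from l j to 0 with a minus sign.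
   The dummy arguments of F outside {1..k} are 0. *)
primrec iterated_integral ::
    "nat \<Rightarrow> (nat \<Rightarrow> real) \<Rightarrow> ((nat \<Rightarrow> real) \<Rightarrow> real) \<Rightarrow> real" where
  "iterated_integral 0 l F = F (\<lambda>_. 0)"
| "iterated_integral (Suc k) l F =
     (LBINT t=0..ereal (l (Suc k)). iterated_integral k l (\<lambda>x. F (x(Suc k := t))))"

definition poly_Cauchy1 ::
    "nat \<Rightarrow> nat \<Rightarrow> (nat \<Rightarrow> real) \<Rightarrow> real \<Rightarrow> (nat \<Rightarrow> real) \<Rightarrow> real" where
  "poly_Cauchy1 n k l z \<alpha> =
     iterated_integral k l (\<lambda>x. \<Prod>i<n. ((\<Prod>j=1..k. x j) - \<alpha> i - z))"

definition poly_Cauchy2 ::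
    "nat \<Rightarrow> nat \<Rightarrow> (nat \<Rightarrow> real) \<Rightarrow> real \<Rightarrow> (nat \<Rightarrow> real) \<Rightarrow> real" where
  "poly_Cauchy2 n k l z \<alpha> =
     iterated_integral k l (\<lambda>x. \<Prod>i<n. (- (\<Prod>j=1..k. x j) - \<alpha> i + z))"

end

theory Submission
  imports Defs
begin

(* Each integrand is a polynomial in the product of the variables, and a monomial in that
   product is a product of one-variable monomials.  So every integration replaces x^e by
   l^(e+1)/(e+1), and the formulas follow from the binomial expansion of (X - z)^m. *)

text \<open>Fundamental theorem of calculus with a termwise antiderivative. The integral is
  oriented, so \<open>b\<close> may have either sign.\<close>

lemma interval_integral_sum_monomials:
  fixes b :: real
  shows "(LBINT t=0..ereal b. (\<Sum>a\<in>A. c a * t ^ e a)) = (\<Sum>a\<in>A. c a * (b ^ (e a + 1) / real (e a + 1)))"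
proof -
  let ?F = "\<lambda>t. \<Sum>a\<in>A. c a * (t ^ (e a + 1) / real (e a + 1))"
  have deriv: "((\<lambda>t. t ^ (e + 1) / real (e + 1)) has_real_derivative t ^ e) (at t within S)"
    for e :: nat and t :: real and S
    using DERIV_cdivide[OF DERIV_pow[of "e + 1" t S], of "real (e + 1)"]
    by (simp add: field_simps del: of_nat_Suc)
  \<comment> \<open>The lower limit is written \<open>ereal 0\<close> because the rule used expects
    both endpoints as embedded reals.\<close>
  have "(LBINT t=ereal 0..ereal b. (\<Sum>a\<in>A. c a * t ^ e a)) = ?F b - ?F 0"
  proof (rule interval_integral_FTC_finite)
    show "continuous_on {min 0 b..max 0 b} (\<lambda>t. \<Sum>a\<in>A. c a * t ^ e a)"
      by (intro continuous_intros)
    show "(?F has_vector_derivative (\<Sum>a\<in>A. c a * t ^ e a)) (at t within {min 0 b..max 0 b})" for t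
      unfolding has_real_derivative_iff_has_vector_derivative[symmetric]
      by (intro DERIV_sum DERIV_cmult deriv)
  qed
  then show ?thesis
    by (simp add: zero_ereal_def)
qed

text \<open>Induction on \<open>k\<close>, peeling off the outermost variable. The index set
  \<open>A\<close> and the exponents \<open>e\<close> are left general so that a double sum can
  later be treated as one sum over pairs.\<close>

lemma iterated_integral_sum_monomials:
  "iterated_integral k l (\<lambda>x. \<Sum>a\<in>A. c a * (\<Prod>j=1..k. x j) ^ e a) =
     (\<Sum>a\<in>A. c a * ((\<Prod>j=1..k. l j) ^ (e a + 1) / real (e a + 1) ^ k))"
proof (induction k arbitrary: c)
  case 0
  then show ?case
    by simp
next
  case (Suc k)
  let ?P = "\<lambda>a. (\<Prod>j=1..k. l j) ^ (e a + 1) / real (e a + 1) ^ k"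
  have split: "(\<Prod>j=1..Suc k. (x(Suc k := t)) j) = t * (\<Prod>j=1..k. x j)" for x :: "nat \<Rightarrow> real" and t
  proof -
    have "(\<Prod>j=1..k. (x(Suc k := t)) j) = (\<Prod>j=1..k. x j)"
      by (intro prod.cong) auto
    then show ?thesis
      by simp
  qed
  \<comment> \<open>For fixed \<open>t\<close> the factor \<open>t ^ e a\<close> is absorbed into
    the coefficient, so the induction hypothesis is applied with \<open>c a * t ^ e a\<close>; this
    is why \<open>c\<close> is generalized.\<close>
  have "iterated_integral k l (\<lambda>x. \<Sum>a\<in>A. c a * (\<Prod>j=1..Suc k. (x(Suc k := t)) j) ^ e a) =
          (\<Sum>a\<in>A. (c a * ?P a) * t ^ e a)" for t
    unfolding split power_mult_distrib mult.assoc[symmetric] Suc.IH by (simp add: mult_ac)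
  then have "iterated_integral (Suc k) l (\<lambda>x. \<Sum>a\<in>A. c a * (\<Prod>j=1..Suc k. x j) ^ e a) =
      (\<Sum>a\<in>A. (c a * ?P a) * (l (Suc k) ^ (e a + 1) / real (e a + 1)))"
    by (simp only: iterated_integral.simps interval_integral_sum_monomials)
  also have "\<dots> = (\<Sum>a\<in>A. c a * ((\<Prod>j=1..Suc k. l j) ^ (e a + 1) / real (e a + 1) ^ Suc k))"
    by (intro sum.cong refl) (simp add: power_mult_distrib mult_ac)
  finally show ?case .
qed

text \<open>Binomial expansion of each power, then exchange of summation over the triangle i \<le> m
  \<le> n. The result is one sum over pairs, so that it is a sum of monomials in \<open>X\<close>
  with exponent \<open>m - i\<close>.\<close>

lemma sum_mult_power_diff:
  fixes X z :: "'a::comm_ring_1"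
  shows "(\<Sum>m=0..n. c m * (X - z) ^ m) =
    (\<Sum>(i, m)\<in>Sigma {0..n} (\<lambda>i. {i..n}). ((-1) ^ i * of_nat (m choose i) * c m * z ^ i) * X ^ (m - i))"
proof -
  have "c m * (X - z) ^ m = (\<Sum>i=0..m. ((-1) ^ i * of_nat (m choose i) * c m * z ^ i) * X ^ (m - i))" for m
    using binomial_ring[of "- z" X m]
    by (simp add: sum_distrib_left atLeast0AtMost power_minus[of z] mult_ac)
  then have "(\<Sum>m=0..n. c m * (X - z) ^ m) =
      (\<Sum>m=0..n. \<Sum>i=0..m. ((-1) ^ i * of_nat (m choose i) * c m * z ^ i) * X ^ (m - i))"
    by simp
  also have "\<dots> = (\<Sum>i=0..n. \<Sum>m=i..n. ((-1) ^ i * of_nat (m choose i) * c m * z ^ i) * X ^ (m - i))"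
    \<comment> \<open>Both double sums become sums over pairs, matched by swapping the
      components.\<close>
    by (subst sum.Sigma, simp, simp, subst sum.Sigma, simp, simp)
      (rule sum.reindex_bij_witness[of _ prod.swap prod.swap], auto)
  finally show ?thesis
    by (simp add: sum.Sigma)
qed

text \<open>Common core of both formulas, which differ only in the coefficients
  \<open>c\<close>.\<close>

lemma iterated_integral_sum_power_diff:
  "iterated_integral k l (\<lambda>x. \<Sum>m=0..n. c m * ((\<Prod>j=1..k. x j) - z) ^ m) =
     (\<Sum>i=0..n. \<Sum>m=i..n. (-1) ^ i * real (m choose i) *
        (c m * (\<Prod>j=1..k. l j) ^ (m - i + 1) / real (m - i + 1) ^ k) * z ^ i)"
  unfolding sum_mult_power_diff case_prod_unfold iterated_integral_sum_monomials
  by (simp add: sum.Sigma case_prod_unfold mult_ac del: of_nat_Suc of_nat_diff)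

theorem theorem5p1:
  fixes n k :: nat and \<alpha> l :: "nat \<Rightarrow> real" and z :: real
  assumes "k \<ge> 1"
    and "\<And>j. j \<in> {1..k} \<Longrightarrow> l j \<noteq> 0"
  shows "poly_Cauchy1 n k l z \<alpha> =
           (\<Sum>i=0..n. \<Sum>m=i..n. (-1) ^ i * real (m choose i) *
              (gen_stirling1 \<alpha> n m * (\<Prod>j=1..k. l j) ^ (m - i + 1) / real (m - i + 1) ^ k) * z ^ i)
       \<and> poly_Cauchy2 n k l z \<alpha> =
           (\<Sum>i=0..n. \<Sum>m=i..n. (-1) ^ (i + n) * real (m choose i) *
              (signless_gen_stirling1 \<alpha> n m * (\<Prod>j=1..k. l j) ^ (m - i + 1) / real (m - i + 1) ^ k) * z ^ i)"
proof
  \<comment> \<open>The defining product of the Stirling numbers, evaluated at the shifted point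
    \<open>X - z\<close>.\<close>
  have "(\<Prod>i<n. X - \<alpha> i - z) = (\<Sum>m=0..n. gen_stirling1 \<alpha> n m * (X - z) ^ m)" for X
    using gen_stirling1_expansion[where x = "X - z"] by (simp add: algebra_simps)
  then show "poly_Cauchy1 n k l z \<alpha> =
           (\<Sum>i=0..n. \<Sum>m=i..n. (-1) ^ i * real (m choose i) *
              (gen_stirling1 \<alpha> n m * (\<Prod>j=1..k. l j) ^ (m - i + 1) / real (m - i + 1) ^ k) * z ^ i)"
    unfolding poly_Cauchy1_def by (simp only: iterated_integral_sum_power_diff)
  \<comment> \<open>Taking -1 out of each of the \<open>n\<close> factors leaves the signless
    product at \<open>X - z\<close>; the sign \<open>(-1) ^ n\<close> goes into the
    coefficients.\<close>
  have "(\<Prod>i<n. - X - \<alpha> i + z) = (\<Sum>m=0..n. ((-1) ^ n * signless_gen_stirling1 \<alpha> n m) * (X - z) ^ m)" for X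
  proof -
    have "(\<Prod>i<n. - X - \<alpha> i + z) = (\<Prod>i<n. (-1) * (X - z + \<alpha> i))"
      by (intro prod.cong) auto
    also have "\<dots> = (-1) ^ n * (\<Prod>i<n. X - z + \<alpha> i)"
      by (simp only: prod.distrib prod_constant card_lessThan)
    finally show ?thesis
      by (simp add: signless_gen_stirling1_expansion sum_distrib_left mult.assoc)
  qed
  then show "poly_Cauchy2 n k l z \<alpha> =
           (\<Sum>i=0..n. \<Sum>m=i..n. (-1) ^ (i + n) * real (m choose i) *
              (signless_gen_stirling1 \<alpha> n m * (\<Prod>j=1..k. l j) ^ (m - i + 1) / real (m - i + 1) ^ k) * z ^ i)"
    unfolding poly_Cauchy2_def
    by (simp only: iterated_integral_sum_power_diff) (simp add: power_add mult_ac)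
qed

end
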